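(* For graphs of bounded degree, finiteness of twin-width is preserved by quasi-isometries, and more generally by regular embeddings. Precisely, let $G$ and $H$ be connected graphs of bounded degree. If there is a $\lambda$-regular embedding $V(H)\to V(G)$ for some $\lambda$ and $G$ has finite twin-width, then $H$ has finite twin-width. In particular, if $G$ and $H$ are quasi-isometric, then $G$ has finite twin-width if and only if $H$ does.
   Context: Graphs are simple, undirected, finite or countably infinite; a connected graph is viewed as the metric space of its vertices with the shortest-path distance. For $\lambda\ge 0$, a map $f:X\to Y$ of metric spaces is a $\lambda$-quasi-isometry if $\lambda^{-1}d_X(x,x')-\lambda\le d_Y(f(x),f(x'))\le\lambda d_X(x,x')+\lambda$ for all $x,x'\in X$ and every $y\in Y$ is at distance at most $\lambda$ from $f(X)$; $X,Y$ are quasi-isometric if there is such a map for some $\lambda$. A map $f:X\to Y$ is a $\lambda$-regular embedding if it is $\lambda$-Lipschitz and $|f^{-1}(y)|\le\lambda$ for all $y\in Y$. For a finite graph $G$ and a partition $\mathcal P$ of $V(G)$, the quotient graph $G/\mathcal P$ has vertex set $\mathcal P$, with distinct parts $X,Y$ adjacent iff some edge $xy$ of $G$ has $x\in X$, $y\in Y$. A partition sequence of $G$ ($|V(G)|=n$) is a sequence $\mathcal P_n,\dots,\mathcal P_1$ of partitions of $V(G)$, where $\mathcal P_n$ is the partition into singletons, $\mathcal P_1=\{V(G)\}$, and each $\mathcal P_{i-1}$ is obtained from $\mathcal P_i$ by merging two parts; its width is $\max_i\Delta(G/\mathcal P_i)$ ($\Delta$ = maximum degree). The strict twin-width $\mathrm{stww}(G)$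 is the minimum width of a partition sequence; for infinite $G$ it is the supremum of $\mathrm{stww}(H)$ over finite induced subgraphs $H$. For graphs of bounded degree, "finite twin-width" means $\mathrm{stww}(G)<\infty$. *)

theory Defs
  imports "HOL-Analysis.Analysis" "HOL-Library.Extended_Nat" "HOL-Library.Disjoint_Sets"
begin

section \<open>Graphs\<close>

text \<open>
  A simple undirected graph is a vertex set with a symmetric irreflexive adjacency relation.
  Only finite and countably infinite graphs are considered. The empty graph is allowed, and it
  counts as connected.
\<close>

record 'a graph =
  verts :: "'a set"
  adj :: "('a \<times> 'a) set"

definition simple_graph :: "'a graph \<Rightarrow> bool" where
  "simple_graph G \<longleftrightarrow>
     countable (verts G) \<and> adj G \<subseteq> verts G \<times> verts G \<and> sym (adj G) \<and> irrefl (adj G)"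

definition connected_graph :: "'a graph \<Rightarrow> bool" where
  "connected_graph G \<longleftrightarrow> (\<forall>u\<in>verts G. \<forall>v\<in>verts G. (u, v) \<in> (adj G)\<^sup>*)"

definition induced_subgraph :: "'a graph \<Rightarrow> 'a set \<Rightarrow> 'a graph" where
  "induced_subgraph G S = \<lparr>verts = S, adj = adj G \<inter> (S \<times> S)\<rparr>"

definition vertex_degree :: "'a graph \<Rightarrow> 'a \<Rightarrow> enat" where
  "vertex_degree G v =
     (if finite (adj G `` {v}) then enat (card (adj G `` {v})) else \<infinity>)"

definition max_degree :: "'a graph \<Rightarrow> enat" where
  "max_degree G = (SUP v\<in>verts G. vertex_degree G v)"

definition bounded_degree :: "'a graph \<Rightarrow> bool" where
  "bounded_degree G \<longleftrightarrow> max_degree G < \<infinity>"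


section \<open>The metric space of a connected graph\<close>

text \<open>A pair lies in the relational power \<open>adj G ^^ k\<close> iff a walk of length \<open>k\<close> joins it.\<close>

definition graph_dist :: "'a graph \<Rightarrow> 'a \<Rightarrow> 'a \<Rightarrow> nat" where
  "graph_dist G u v = (LEAST k. (u, v) \<in> adj G ^^ k)"

definition graph_metric :: "'a graph \<Rightarrow> 'a metric" where
  "graph_metric G = metric (verts G, \<lambda>u v. real (graph_dist G u v))"

lemma graph_dist_walk:
  assumes "connected_graph G" "u \<in> verts G" "v \<in> verts G"
  shows "(u, v) \<in> adj G ^^ graph_dist G u v"
proof -
  have "\<exists>k. (u, v) \<in> adj G ^^ k"
    using assms unfolding connected_graph_def by (meson rtrancl_imp_relpow)
  then show ?thesis
    unfolding graph_dist_def by (rule LeastI_ex)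
qed

lemma graph_dist_le: "(u, v) \<in> adj G ^^ k \<Longrightarrow> graph_dist G u v \<le> k"
  unfolding graph_dist_def by (rule Least_le)

lemma sym_relpow:
  assumes "sym r"
  shows "(u, v) \<in> r ^^ k \<longleftrightarrow> (v, u) \<in> r ^^ k"
proof -
  have "(v, u) \<in> r ^^ k" if "(u, v) \<in> r ^^ k" for u v
    using that
  proof (induction k arbitrary: u)
    case (Suc k)
    obtain w where "(u, w) \<in> r" "(w, v) \<in> r ^^ k"
      using relpow_Suc_D2[OF Suc.prems] by blast
    then show ?case
      using Suc.IH[of w] assms by (meson relpow_Suc_I symD)
  qed auto
  then show ?thesis by blast
qed

lemma Metric_space_graph_dist:
  assumes "simple_graph G" "connected_graph G"
  shows "Metric_space (verts G) (\<lambda>u v. real (graph_dist G u v))"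
proof
  fix u v
  have "sym (adj G)" using assms(1) by (simp add: simple_graph_def)
  then show "real (graph_dist G u v) = real (graph_dist G v u)"
    unfolding graph_dist_def using sym_relpow by metis
next
  fix u v assume uv: "u \<in> verts G" "v \<in> verts G"
  show "real (graph_dist G u v) = 0 \<longleftrightarrow> u = v"
    using graph_dist_walk[OF assms(2) uv] graph_dist_le[where u = u and v = v and G = G and k = 0] by auto
next
  fix u v w assume uvw: "u \<in> verts G" "v \<in> verts G" "w \<in> verts G"
  have "(u, w) \<in> adj G ^^ (graph_dist G u v + graph_dist G v w)"
    using graph_dist_walk[OF assms(2) uvw(1,2)] graph_dist_walk[OF assms(2) uvw(2,3)]
    by (auto simp: relpow_add)
  from graph_dist_le[OF this]
  show "real (graph_dist G u w) \<le> real (graph_dist G u v) + real (graph_dist G v w)"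
    by linarith
qed simp

lemma mspace_graph_metric:
  "simple_graph G \<Longrightarrow> connected_graph G \<Longrightarrow> mspace (graph_metric G) = verts G"
  by (simp add: graph_metric_def Metric_space.mspace_metric Metric_space_graph_dist)

lemma mdist_graph_metric:
  "simple_graph G \<Longrightarrow> connected_graph G \<Longrightarrow>
     mdist (graph_metric G) u v = real (graph_dist G u v)"
  by (simp add: graph_metric_def Metric_space.mdist_metric Metric_space_graph_dist)


section \<open>Quasi-isometries and regular embeddings\<close>

text \<open>
  The constant of a quasi-isometry has to be positive for \<open>1 / c\<close> to be meaningful. With the
  convention \<open>1 / 0 = 0\<close>, the value \<open>c = 0\<close> would relate every space to a point.
\<close>

definition quasi_isometry :: "real \<Rightarrow> 'a metric \<Rightarrow> 'b metric \<Rightarrow> ('a \<Rightarrow> 'b) \<Rightarrow> bool" where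
  "quasi_isometry c X Y f \<longleftrightarrow>
     c > 0 \<and> f \<in> mspace X \<rightarrow> mspace Y \<and>
     (\<forall>x\<in>mspace X. \<forall>x'\<in>mspace X.
        1 / c * mdist X x x' - c \<le> mdist Y (f x) (f x') \<and>
        mdist Y (f x) (f x') \<le> c * mdist X x x' + c) \<and>
     (\<forall>y\<in>mspace Y. \<exists>x\<in>mspace X. mdist Y y (f x) \<le> c)"

definition quasi_isometric :: "'a metric \<Rightarrow> 'b metric \<Rightarrow> bool" where
  "quasi_isometric X Y \<longleftrightarrow> (\<exists>c f. quasi_isometry c X Y f)"

definition regular_embedding :: "real \<Rightarrow> 'a metric \<Rightarrow> 'b metric \<Rightarrow> ('a \<Rightarrow> 'b) \<Rightarrow> bool" where
  "regular_embedding c X Y f \<longleftrightarrow>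
     c \<ge> 0 \<and> f \<in> mspace X \<rightarrow> mspace Y \<and>
     (\<forall>x\<in>mspace X. \<forall>x'\<in>mspace X. mdist Y (f x) (f x') \<le> c * mdist X x x') \<and>
     (\<forall>y\<in>mspace Y. finite {x \<in> mspace X. f x = y} \<and> real (card {x \<in> mspace X. f x = y}) \<le> c)"


section \<open>Strict twin-width\<close>

definition quotient_graph :: "'a graph \<Rightarrow> 'a set set \<Rightarrow> 'a set graph" where
  "quotient_graph G P =
     \<lparr>verts = P,
      adj = {(X, Y). X \<in> P \<and> Y \<in> P \<and> X \<noteq> Y \<and> (\<exists>x\<in>X. \<exists>y\<in>Y. (x, y) \<in> adj G)}\<rparr>"

definition merges_to :: "'a set set \<Rightarrow> 'a set set \<Rightarrow> bool" where
  "merges_to P Q \<longleftrightarrow> (\<exists>X\<in>P. \<exists>Y\<in>P. X \<noteq> Y \<and> Q = insert (X \<union> Y) (P - {X, Y}))"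

text \<open>
  A partition sequence of a graph on \<open>n\<close> vertices is a function on indices, of which only
  \<open>P n, \<dots>, P 1\<close> matter. For \<open>n = 0\<close> the sequence is empty and has width 0.
\<close>

definition partition_sequence :: "'a graph \<Rightarrow> (nat \<Rightarrow> 'a set set) \<Rightarrow> bool" where
  "partition_sequence G P \<longleftrightarrow>
     (let n = card (verts G) in
        (\<forall>i\<in>{1..n}. partition_on (verts G) (P i)) \<and>
        P n = (\<lambda>v. {v}) ` verts G \<and>
        P 1 = {verts G} \<and>
        (\<forall>i\<in>{2..n}. merges_to (P i) (P (i - 1))))"

definition sequence_width :: "'a graph \<Rightarrow> (nat \<Rightarrow> 'a set set) \<Rightarrow> enat" where
  "sequence_width G P = (SUP i\<in>{1..card (verts G)}. max_degree (quotient_graph G (P i)))"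

text \<open>The infimum is a minimum: a finite graph has a partition sequence, and \<^typ>\<open>enat\<close> is
  well-ordered.\<close>

definition stww_finite :: "'a graph \<Rightarrow> enat" where
  "stww_finite G = (INF P\<in>{P. partition_sequence G P}. sequence_width G P)"

definition stww :: "'a graph \<Rightarrow> enat" where
  "stww G =
     (if finite (verts G) then stww_finite G
      else (SUP S\<in>{S. finite S \<and> S \<subseteq> verts G}. stww_finite (induced_subgraph G S)))"

text \<open>For graphs of bounded degree, finite twin-width means finite strict twin-width.\<close>

definition finite_twin_width :: "'a graph \<Rightarrow> bool" where
  "finite_twin_width G \<longleftrightarrow> stww G < \<infinity>"

end

theory Submission
  imports Defs
begin

text \<open>
  Strict twin-width counts all edges of the quotients, so it passes to powers of a graph: walks
  of length at most \<open>k\<close> in \<open>F\<close> project to such walks in \<open>F / P\<close>, hence a quotient of \<open>F\<close> of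
  degree at most \<open>t\<close> gives a quotient of the \<open>k\<close>-th power of degree at most \<open>(t + 1)\<^sup>k\<close>. A regular
  embedding maps a finite subgraph of \<open>H\<close> into the \<open>k\<close>-th power of a finite subgraph of \<open>G\<close> that
  contains the required geodesics. A partition sequence for \<open>H\<close> first merges each (small) fibre to
  a point and then follows the pullback of a partition sequence for \<open>G\<close>. For graphs of bounded
  degree, a quasi-isometry and a quasi-inverse of it are regular embeddings, since balls have
  bounded size.
\<close>

section \<open>Walks of bounded length: ball sizes and finite support\<close>

section \<open>Degrees and walks\<close>

lemma max_degree_le_iff:
  "max_degree G \<le> enat w \<longleftrightarrow>
     (\<forall>v\<in>verts G. finite (adj G `` {v}) \<and> card (adj G `` {v}) \<le> w)"
  unfolding max_degree_def SUP_le_iff by (auto simp: vertex_degree_def)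

lemma relpow_mono_rel:
  fixes r s :: "('a \<times> 'a) set"
  assumes "r \<subseteq> s"
  shows "r ^^ k \<subseteq> s ^^ k"
  using assms by (induction k) (auto intro: relpow_Suc_I)

text \<open>A walk in the reflexive closure may stand still, so \<open>(r\<^sup>=) ^^ k\<close>
  encodes walks of length at most \<open>k\<close> as a single relational power. All later distance
  bounds are stated in this form.\<close>

lemma reflcl_relpow_mono:
  fixes r :: "('a \<times> 'a) set"
  assumes "j \<le> k"
  shows "(r\<^sup>=) ^^ j \<subseteq> (r\<^sup>=) ^^ k"
  using assms
proof (induction k rule: dec_induct)
  case (step k)
  then show ?case by (auto intro: relpow_Suc_I)
qed simp

lemma relpow_subset_reflcl_relpow:
  fixes r :: "('a \<times> 'a) set"
  assumes "j \<le> k"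
  shows "r ^^ j \<subseteq> (r\<^sup>=) ^^ k"
proof -
  have "r ^^ j \<subseteq> (r\<^sup>=) ^^ j" by (rule relpow_mono_rel) auto
  then show ?thesis using reflcl_relpow_mono[OF assms, of r] by blast
qed

lemma relpow_Image_bound:
  fixes r :: "('a \<times> 'a) set"
  assumes "\<And>v. finite (r `` {v})" "\<And>v. card (r `` {v}) \<le> d"
  shows "finite ((r ^^ k) `` {v}) \<and> card ((r ^^ k) `` {v}) \<le> d ^ k"
proof (induction k)
  case (Suc k)
  have eq: "(r ^^ Suc k) `` {v} = (\<Union>u\<in>(r ^^ k) `` {v}. r `` {u})" by auto
  have "card (\<Union>u\<in>(r ^^ k) `` {v}. r `` {u}) \<le> (\<Sum>u\<in>(r ^^ k) `` {v}. card (r `` {u}))"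
    using Suc by (intro card_UN_le) auto
  also have "\<dots> \<le> (\<Sum>u\<in>(r ^^ k) `` {v}. d)" by (intro sum_mono assms)
  also have "\<dots> \<le> d ^ Suc k" using Suc by (simp add: mult.commute)
  finally show ?case using Suc assms(1) unfolding eq by blast
qed simp

text \<open>The base is \<open>d + 1\<close> because the reflexive closure adds the centre to each
  neighbourhood. Points outside \<open>verts G\<close> have no neighbours, so the one-step bound
  holds at every point of the type, as \<open>relpow_Image_bound\<close> requires.\<close>

lemma ball_card_le:
  assumes "adj G \<subseteq> verts G \<times> verts G" "max_degree G \<le> enat d"
  shows "finite (((adj G)\<^sup>= ^^ k) `` {v})"
    and "card (((adj G)\<^sup>= ^^ k) `` {v}) \<le> (d + 1) ^ k"
proof -
  have nb: "finite (adj G `` {v}) \<and> card (adj G `` {v}) \<le> d" for v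
  proof (cases "v \<in> verts G")
    case True
    then show ?thesis using assms(2) by (simp add: max_degree_le_iff)
  next
    case False
    then have "adj G `` {v} = {}" using assms(1) by auto
    then show ?thesis by simp
  qed
  have eq: "(adj G)\<^sup>= `` {v} = insert v (adj G `` {v})" for v by auto
  have "card ((adj G)\<^sup>= `` {v}) \<le> d + 1" for v
    unfolding eq using nb[of v] by (metis Suc_eq_plus1 card_insert_if le_SucI not_less_eq_eq)
  moreover have "finite ((adj G)\<^sup>= `` {v})" for v unfolding eq using nb by simp
  ultimately show "finite (((adj G)\<^sup>= ^^ k) `` {v})"
    and "card (((adj G)\<^sup>= ^^ k) `` {v}) \<le> (d + 1) ^ k"
    using relpow_Image_bound[of "(adj G)\<^sup>=" "d + 1" k v] by auto
qed

text \<open>A single walk uses finitely many edges, and finitely many walks still do. This later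
  yields a finite subgraph of \<open>G\<close> in which prescribed pairs stay joined by short
  walks.\<close>

lemma relpow_finite_subrel:
  fixes r :: "('a \<times> 'a) set"
  assumes "finite E" "E \<subseteq> r ^^ k"
  shows "\<exists>s\<subseteq>r. finite s \<and> E \<subseteq> s ^^ k"
proof -
  have one: "\<exists>s\<subseteq>r. finite s \<and> (u, v) \<in> s ^^ k" if "(u, v) \<in> r ^^ k" for u v k
    using that
  proof (induction k arbitrary: v)
    case 0
    then show ?case by (intro exI[of _ "{}"]) auto
  next
    case (Suc k)
    then obtain w where w: "(u, w) \<in> r ^^ k" "(w, v) \<in> r" by auto
    obtain s where s: "s \<subseteq> r" "finite s" "(u, w) \<in> s ^^ k" using Suc.IH[OF w(1)] by blast
    have "s ^^ k \<subseteq> (insert (w, v) s) ^^ k" by (rule relpow_mono_rel) auto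
    then have "(u, v) \<in> (insert (w, v) s) ^^ Suc k" using s(3) by (auto intro: relpow_Suc_I)
    then show ?case using s w(2) by (intro exI[of _ "insert (w, v) s"]) auto
  qed
  show ?thesis
    using assms
  proof (induction E)
    case empty
    then show ?case by blast
  next
    case (insert e E)
    then obtain s where s: "s \<subseteq> r" "finite s" "E \<subseteq> s ^^ k" by blast
    obtain u v where e: "e = (u, v)" by fastforce
    obtain s' where s': "s' \<subseteq> r" "finite s'" "(u, v) \<in> s' ^^ k"
      using one[of u v k] insert.prems e by auto
    have "s ^^ k \<subseteq> (s \<union> s') ^^ k" "s' ^^ k \<subseteq> (s \<union> s') ^^ k" by (rule relpow_mono_rel; auto)+
    then show ?case using s s' e by (intro exI[of _ "s \<union> s'"]) auto
  qed
qed

section \<open>Partition sequences as paths of merges\<close>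

section \<open>Contraction paths\<close>

text \<open>The invariants are imposed on both ends, so every partition on a nonempty path satisfies
  them, and paths can be concatenated by transitivity of the closure.\<close>

definition contraction_step :: "'a graph \<Rightarrow> nat \<Rightarrow> 'a set set \<Rightarrow> 'a set set \<Rightarrow> bool" where
  "contraction_step G w P Q \<longleftrightarrow> merges_to P Q \<and>
     partition_on (verts G) P \<and> partition_on (verts G) Q \<and>
     max_degree (quotient_graph G P) \<le> enat w \<and> max_degree (quotient_graph G Q) \<le> enat w"

lemma merge_blocks:
  assumes "partition_on A P" "finite A" "X \<in> P" "Y \<in> P" "X \<noteq> Y"
  shows "partition_on A (insert (X \<union> Y) (P - {X, Y}))"
    and "card P = Suc (card (insert (X \<union> Y) (P - {X, Y})))"
proof -
  have disj: "Z \<inter> Z' = {}" if "Z \<in> P" "Z' \<in> P" "Z \<noteq> Z'" for Z Z'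
    using assms(1) that by (auto simp: partition_on_def disjoint_def)
  have ne: "{} \<notin> P" using assms(1) by (simp add: partition_on_def)
  show "partition_on A (insert (X \<union> Y) (P - {X, Y}))"
  proof (rule partition_onI)
    show "\<Union> (insert (X \<union> Y) (P - {X, Y})) = A"
      using assms by (auto simp: partition_on_def)
    show "disjnt p q" if "p \<in> insert (X \<union> Y) (P - {X, Y})" "q \<in> insert (X \<union> Y) (P - {X, Y})"
      "p \<noteq> q" for p q
      using that disj assms(3,4) unfolding disjnt_def by blast
    show "{} \<notin> insert (X \<union> Y) (P - {X, Y})" using ne assms(3) by auto
  qed
  \<comment> \<open>If the union were already a block, merging would lower the number of blocks by
    two; but it would then be disjoint from the nonempty \<open>X\<close>.\<close>
  have notin: "X \<union> Y \<notin> P - {X, Y}"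
  proof
    assume "X \<union> Y \<in> P - {X, Y}"
    then have "(X \<union> Y) \<inter> X = {}" using disj[of "X \<union> Y" X] assms(3) by auto
    then have "X = {}" by auto
    then show False using ne assms(3) by simp
  qed
  have fin: "finite P" using assms(1,2) finite_elements by blast
  have "card (P - {X, Y}) = card P - 2" using assms fin by (simp add: card_Diff_subset)
  moreover have "card {X, Y} \<le> card P" using assms(3,4) fin by (intro card_mono) auto
  ultimately show "card P = Suc (card (insert (X \<union> Y) (P - {X, Y})))"
    using notin fin assms(5) by simp
qed

lemma merges_to_card:
  assumes "merges_to P Q" "partition_on A P" "finite A"
  shows "card P = Suc (card Q)"
  using assms merge_blocks(2) unfolding merges_to_def by metis

text \<open>Each merge lowers the number of blocks by exactly one, so a partition on the path can be
  indexed by its number of blocks. A path without steps says nothing about its start, hence the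
  separate assumptions on \<open>P\<close>.\<close>

lemma contraction_path_sequence:
  assumes "(contraction_step G w)\<^sup>*\<^sup>* P R" "finite (verts G)"
    "partition_on (verts G) P" "max_degree (quotient_graph G P) \<le> enat w"
  shows "card R \<le> card P \<and> (\<exists>p. p (card P) = P \<and> p (card R) = R \<and>
    (\<forall>i\<in>{card R..card P}. partition_on (verts G) (p i) \<and>
        max_degree (quotient_graph G (p i)) \<le> enat w) \<and>
    (\<forall>i\<in>{Suc (card R)..card P}. merges_to (p i) (p (i - 1))))"
  using assms
proof (induction rule: converse_rtranclp_induct)
  case base
  then show ?case by (intro conjI exI[of _ "\<lambda>_. R"]) auto
next
  case (step P Q)
  have c: "card P = Suc (card Q)"
    using merges_to_card step.hyps(1) step.prems(1) unfolding contraction_step_def by metis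
  obtain p where p: "card R \<le> card Q" "p (card Q) = Q" "p (card R) = R"
    "\<forall>i\<in>{card R..card Q}. partition_on (verts G) (p i) \<and>
        max_degree (quotient_graph G (p i)) \<le> enat w"
    "\<forall>i\<in>{Suc (card R)..card Q}. merges_to (p i) (p (i - 1))"
    using step.IH step.hyps(1) step.prems(1) unfolding contraction_step_def by blast
  \<comment> \<open>Since \<open>card P = Suc (card Q)\<close>, the new partition takes the first
    index above the sequence built so far and overwrites nothing in it.\<close>
  define p' where "p' = p(card P := P)"
  have low: "p' i = p i" if "i \<le> card Q" for i using that c by (simp add: p'_def)
  have "p' (card P) = P" by (simp add: p'_def)
  moreover have "p' (card R) = R" using low p by simp
  moreover have "partition_on (verts G) (p' i) \<and> max_degree (quotient_graph G (p' i)) \<le> enat w"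
    if "i \<in> {card R..card P}" for i
    using that p(4) step.prems(2,3) low by (cases "i = card P") (auto simp: c p'_def)
  moreover have "merges_to (p' i) (p' (i - 1))" if "i \<in> {Suc (card R)..card P}" for i
  proof (cases "i = card P")
    case True
    have "p' (i - 1) = Q" using low[of "card Q"] p(2) True c by simp
    then show ?thesis using True step.hyps(1) \<open>p' (card P) = P\<close> by (simp add: contraction_step_def)
  next
    case False
    then have "i \<le> card Q" "i - 1 \<le> card Q" using that c by auto
    then show ?thesis using that p(5) low by simp
  qed
  ultimately show ?case using p(1) c by (intro conjI exI[of _ p']) auto
qed

lemma stww_finite_le:
  assumes fin: "finite (verts G)" and ne: "verts G \<noteq> {}"
    and deg: "max_degree (quotient_graph G ((\<lambda>v. {v}) ` verts G)) \<le> enat w"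
    and path: "(contraction_step G w)\<^sup>*\<^sup>* ((\<lambda>v. {v}) ` verts G) {verts G}"
  shows "stww_finite G \<le> enat w"
proof -
  have c: "card ((\<lambda>v. {v}) ` verts G) = card (verts G)" by (simp add: card_image)
  obtain p where p: "p (card (verts G)) = (\<lambda>v. {v}) ` verts G" "p 1 = {verts G}"
    "\<forall>i\<in>{1..card (verts G)}. partition_on (verts G) (p i) \<and>
        max_degree (quotient_graph G (p i)) \<le> enat w"
    "\<forall>i\<in>{2..card (verts G)}. merges_to (p i) (p (i - 1))"
    using contraction_path_sequence[OF path fin partition_on_singletons deg]
    unfolding c by (auto simp: numeral_2_eq_2)
  have "partition_sequence G p" using p by (simp add: partition_sequence_def Let_def)
  moreover have "sequence_width G p \<le> enat w"
    using p(3) by (simp add: sequence_width_def SUP_le_iff)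
  ultimately show ?thesis
    unfolding stww_finite_def by (metis (mono_tags, lifting) INF_lower2 mem_Collect_eq)
qed

text \<open>With no vertices, index 0 requires the empty set of singletons and index 1 requires
  \<open>{{}}\<close>; the range \<open>{1..0}\<close> is empty, so the width is the supremum of the
  empty set.\<close>

lemma stww_finite_empty:
  assumes "verts G = {}"
  shows "stww_finite G = 0"
proof -
  have "partition_sequence G (\<lambda>i. if i = 0 then {} else {{}})"
    using assms by (simp add: partition_sequence_def)
  moreover have "sequence_width G P = 0" for P
    using assms by (simp add: sequence_width_def bot_enat_def)
  ultimately have "stww_finite G \<le> 0"
    unfolding stww_finite_def by (metis (mono_tags, lifting) INF_lower mem_Collect_eq)
  then show ?thesis by simp
qed

text \<open>An infimum strictly below \<open>Suc t\<close> has a member strictly below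
  \<open>Suc t\<close>; discreteness of \<open>enat\<close> turns this back into a bound by
  \<open>t\<close>.\<close>

lemma stww_finite_obtain:
  assumes "stww_finite G \<le> enat t"
  obtains P where "partition_sequence G P" "sequence_width G P \<le> enat t"
proof -
  have "stww_finite G < enat (Suc t)" using assms by (meson enat_ord_simps(2) le_less_trans lessI)
  then obtain P where "partition_sequence G P" "sequence_width G P < enat (Suc t)"
    unfolding stww_finite_def INF_less_iff by blast
  moreover from this have "sequence_width G P \<le> enat t"
    by (cases "sequence_width G P") auto
  ultimately show ?thesis using that by blast
qed

text \<open>Induction on the number of blocks: two blocks of \<open>P\<close> inside one block of
  \<open>Q\<close> can be merged without leaving the refinements of \<open>Q\<close>. The relation
  records refinement at both ends, so that degree bounds valid for all refinements of
  \<open>Q\<close> apply along the path.\<close>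

lemma refines_merge_path:
  assumes "finite A" "refines A P Q"
  shows "(\<lambda>R R'. merges_to R R' \<and> refines A R Q \<and> refines A R' Q)\<^sup>*\<^sup>* P Q"
  using assms(2)
proof (induction "card P" arbitrary: P rule: less_induct)
  case less
  have parts: "partition_on A P" "partition_on A Q" and sub: "\<And>X. X \<in> P \<Longrightarrow> \<exists>Z\<in>Q. X \<subseteq> Z"
    using less.prems by (auto simp: refines_def)
  show ?case
  proof (cases "\<exists>Z\<in>Q. \<exists>X\<in>P. \<exists>Y\<in>P. X \<noteq> Y \<and> X \<subseteq> Z \<and> Y \<subseteq> Z")
    case True
    then obtain Z X Y where Z: "Z \<in> Q" "X \<in> P" "Y \<in> P" "X \<noteq> Y" "X \<subseteq> Z" "Y \<subseteq> Z" by blast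
    define P' where "P' = insert (X \<union> Y) (P - {X, Y})"
    note P' = merge_blocks[OF parts(1) assms(1) Z(2,3,4), folded P'_def]
    have m: "merges_to P P'" unfolding merges_to_def P'_def using Z(2,3,4) by blast
    have ref: "refines A P' Q"
      unfolding refines_def
    proof (intro conjI ballI P'(1) parts(2))
      fix X' assume "X' \<in> P'"
      then show "\<exists>Y\<in>Q. X' \<subseteq> Y"
        using sub Z unfolding P'_def by (metis Diff_iff Un_subset_iff insert_iff)
    qed
    have "(\<lambda>R R'. merges_to R R' \<and> refines A R Q \<and> refines A R' Q)\<^sup>*\<^sup>* P' Q"
      using less.hyps[of P'] P'(2) ref by simp
    then show ?thesis using m ref less.prems by (simp add: converse_rtranclp_into_rtranclp)
  next
    case False
    \<comment> \<open>Each block of \<open>Q\<close> is the union of the blocks of \<open>P\<close>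
      inside it, and here there is only one of these. Mutual refinement then forces
      equality.\<close>
    have "refines A Q P"
      unfolding refines_def
    proof (intro conjI ballI parts)
      fix Z assume Z: "Z \<in> Q"
      have "partition_on Z {X \<in> P. X \<subseteq> Z}"
        using refines_obtains_subset[OF less.prems Z] .
      then have un: "Z = \<Union>{X \<in> P. X \<subseteq> Z}" by (rule partition_onD1)
      have "Z \<noteq> {}" using parts(2) Z by (auto simp: partition_on_def)
      then obtain X where X: "X \<in> P" "X \<subseteq> Z" using un by blast
      have "{X \<in> P. X \<subseteq> Z} = {X}" using X False Z by blast
      then show "\<exists>X\<in>P. Z \<subseteq> X" using un X by auto
    qed
    then have "P = Q" using less.prems refines_asym by blast
    then show ?thesis by simp
  qed
qed

section \<open>Transfer of strict twin-width along maps with small fibres\<close>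

section \<open>Pulling back partition sequences\<close>

text \<open>An edge between two blocks projects to an edge of the quotient and an edge inside a
  block to a pause, which the reflexive closure permits.\<close>

lemma quotient_walk:
  assumes adj: "adj F \<subseteq> verts F \<times> verts F" and P: "partition_on (verts F) P"
    and walk: "(x, y) \<in> (adj F)\<^sup>= ^^ k" and "x \<in> X" "X \<in> P" "y \<in> Y" "Y \<in> P"
  shows "(X, Y) \<in> (adj (quotient_graph F P))\<^sup>= ^^ k"
  using walk \<open>y \<in> Y\<close> \<open>Y \<in> P\<close>
proof (induction k arbitrary: y Y)
  case 0
  then have "X \<inter> Y \<noteq> {}" using \<open>x \<in> X\<close> by auto
  then have "X = Y" using P \<open>X \<in> P\<close> \<open>Y \<in> P\<close> by (auto simp: partition_on_def disjoint_def)
  then show ?case by simp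
next
  case (Suc k)
  then obtain z where z: "(x, z) \<in> (adj F)\<^sup>= ^^ k" "(z, y) \<in> (adj F)\<^sup>=" by auto
  have "y \<in> verts F" using Suc.prems P by (auto simp: partition_on_def)
  then have "z \<in> verts F" using z(2) adj by auto
  then obtain Z where Z: "z \<in> Z" "Z \<in> P" using P by (auto simp: partition_on_def)
  have 1: "(X, Z) \<in> (adj (quotient_graph F P))\<^sup>= ^^ k" using Suc.IH[OF z(1) Z] .
  have "(Z, Y) \<in> (adj (quotient_graph F P))\<^sup>="
  proof (cases "Z = Y")
    case False
    then have "z \<noteq> y"
      using P Z Suc.prems unfolding partition_on_def disjoint_def by blast
    then show ?thesis using z(2) Z Suc.prems False by (auto simp: quotient_graph_def)
  qed simp
  then show ?case using 1 by (auto intro: relpow_Suc_I)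
qed

text \<open>An edge of \<open>K\<close> from \<open>B\<close> to \<open>B'\<close> puts
  \<open>h B'\<close> into the ball of radius \<open>k\<close> around \<open>h B\<close> in
  \<open>F / P\<close>. This ball has at most \<open>(t + 1) ^ k\<close> members, and each of them
  is \<open>h B'\<close> for at most \<open>m\<close> blocks \<open>B'\<close>.\<close>

lemma quotient_degree_bound:
  fixes F :: "'a graph" and K :: "'b graph"
  assumes adj: "adj F \<subseteq> verts F \<times> verts F" and P: "partition_on (verts F) P"
    and deg: "max_degree (quotient_graph F P) \<le> enat t"
    and walk: "\<And>x y. (x, y) \<in> adj K \<Longrightarrow> (f x, f y) \<in> (adj F)\<^sup>= ^^ k"
    and h: "\<And>B. B \<in> Q \<Longrightarrow> h B \<in> P \<and> f ` B \<subseteq> h B"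
    and mult: "\<And>X. X \<in> P \<Longrightarrow> finite {B \<in> Q. h B = X} \<and> card {B \<in> Q. h B = X} \<le> m"
  shows "max_degree (quotient_graph K Q) \<le> enat (m * (t + 1) ^ k)"
  unfolding max_degree_le_iff
proof
  fix B assume "B \<in> verts (quotient_graph K Q)"
  then have B: "B \<in> Q" by (simp add: quotient_graph_def)
  define W where "W = ((adj (quotient_graph F P))\<^sup>= ^^ k) `` {h B} \<inter> P"
  have q: "adj (quotient_graph F P) \<subseteq> verts (quotient_graph F P) \<times> verts (quotient_graph F P)"
    by (auto simp: quotient_graph_def)
  note ball = ball_card_le[OF q deg, of k "h B"]
  have finW: "finite W" using ball(1) by (simp add: W_def)
  have "card W \<le> card (((adj (quotient_graph F P))\<^sup>= ^^ k) `` {h B})"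
    unfolding W_def by (rule card_mono[OF ball(1)]) auto
  then have cardW: "card W \<le> (t + 1) ^ k" using ball(2) by linarith
  have sub: "adj (quotient_graph K Q) `` {B} \<subseteq> (\<Union>X\<in>W. {B' \<in> Q. h B' = X})"
  proof
    fix B' assume "B' \<in> adj (quotient_graph K Q) `` {B}"
    then obtain x y where xy: "B' \<in> Q" "x \<in> B" "y \<in> B'" "(x, y) \<in> adj K"
      by (auto simp: quotient_graph_def)
    have "f x \<in> h B" "f y \<in> h B'" using h[OF B] h[OF xy(1)] xy by auto
    then have "(h B, h B') \<in> (adj (quotient_graph F P))\<^sup>= ^^ k"
      using quotient_walk[OF adj P walk[OF xy(4)]] h[OF B] h[OF xy(1)] by blast
    then have "h B' \<in> W" using h[OF xy(1)] by (simp add: W_def)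
    then show "B' \<in> (\<Union>X\<in>W. {B' \<in> Q. h B' = X})" using xy(1) by blast
  qed
  have fin: "finite (\<Union>X\<in>W. {B' \<in> Q. h B' = X})"
    using finW mult by (auto simp: W_def)
  have "card (\<Union>X\<in>W. {B' \<in> Q. h B' = X}) \<le> (\<Sum>X\<in>W. card {B' \<in> Q. h B' = X})"
    by (rule card_UN_le[OF finW])
  also have "\<dots> \<le> (\<Sum>X\<in>W. m)" using mult by (intro sum_mono) (auto simp: W_def)
  also have "\<dots> \<le> m * (t + 1) ^ k" using cardW by (simp add: mult.commute)
  finally have "card (\<Union>X\<in>W. {B' \<in> Q. h B' = X}) \<le> m * (t + 1) ^ k" .
  then show "finite (adj (quotient_graph K Q) `` {B}) \<and>
      card (adj (quotient_graph K Q) `` {B}) \<le> m * (t + 1) ^ k"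
    using sub fin card_mono[OF fin sub] finite_subset by fastforce
qed

text \<open>Blocks that \<open>f\<close> misses have empty preimages, which a partition must not
  contain.\<close>

definition pullback :: "'b set \<Rightarrow> ('b \<Rightarrow> 'a) \<Rightarrow> 'a set set \<Rightarrow> 'b set set" where
  "pullback S f P = (\<lambda>X. {x \<in> S. f x \<in> X}) ` P - {{}}"

lemma partition_on_pullback:
  assumes "partition_on A P" "f \<in> S \<rightarrow> A"
  shows "partition_on S (pullback S f P)"
proof (rule partition_onI)
  show "\<Union> (pullback S f P) = S"
  proof
    show "S \<subseteq> \<Union> (pullback S f P)"
    proof
      fix x assume x: "x \<in> S"
      then have "f x \<in> A" using assms(2) by blast
      then obtain X where "X \<in> P" "f x \<in> X" using assms(1) by (auto simp: partition_on_def)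
      then have "{x \<in> S. f x \<in> X} \<in> pullback S f P" "x \<in> {x \<in> S. f x \<in> X}"
        using x by (auto simp: pullback_def)
      then show "x \<in> \<Union> (pullback S f P)" by (rule UnionI)
    qed
  qed (auto simp: pullback_def)
  show "disjnt p q" if "p \<in> pullback S f P" "q \<in> pullback S f P" "p \<noteq> q" for p q
  proof -
    obtain X Y where XY: "X \<in> P" "Y \<in> P" "p = {x \<in> S. f x \<in> X}" "q = {x \<in> S. f x \<in> Y}"
      using \<open>p \<in> pullback S f P\<close> \<open>q \<in> pullback S f P\<close> by (auto simp: pullback_def)
    then have "X \<inter> Y = {}"
      using assms(1) \<open>p \<noteq> q\<close> by (auto simp: partition_on_def disjoint_def)
    then show ?thesis using XY by (auto simp: disjnt_def)
  qed
  show "{} \<notin> pullback S f P" by (simp add: pullback_def)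
qed

text \<open>If one of the two merged blocks has empty preimage, the pullback does not change;
  otherwise the two preimages are merged.\<close>

lemma merges_to_pullback:
  assumes "merges_to P P'" "partition_on A P"
  shows "pullback S f P' = pullback S f P \<or> merges_to (pullback S f P) (pullback S f P')"
proof -
  define g where "g = (\<lambda>X. {x \<in> S. f x \<in> X})"
  have pb: "pullback S f R = g ` R - {{}}" for R by (simp add: pullback_def g_def)
  obtain X Y where XY: "X \<in> P" "Y \<in> P" "X \<noteq> Y" "P' = insert (X \<union> Y) (P - {X, Y})"
    using assms(1) by (auto simp: merges_to_def)
  have disj: "g Z \<inter> g Z' = {}" if "Z \<in> P" "Z' \<in> P" "Z \<noteq> Z'" for Z Z'
    using assms(2) that by (auto simp: partition_on_def disjoint_def g_def)
  have un: "g (X \<union> Y) = g X \<union> g Y" by (auto simp: g_def)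
  have P': "pullback S f P' = insert (g X \<union> g Y) (g ` (P - {X, Y})) - {{}}"
    unfolding pb XY(4) by (simp add: un)
  have P: "pullback S f P = insert (g X) (insert (g Y) (g ` (P - {X, Y}))) - {{}}"
    unfolding pb using XY(1,2) by blast
  show ?thesis
  proof (cases "g X = {} \<or> g Y = {}")
    case True
    then have "pullback S f P' = pullback S f P" unfolding P P' by auto
    then show ?thesis ..
  next
    case False
    \<comment> \<open>The sets \<open>g X\<close> and \<open>g Y\<close> are nonempty and disjoint
      from each other and from all members of \<open>B\<close>, so deleting both from the pullback
      leaves exactly the nonempty members of \<open>B\<close>.\<close>
    define B where "B = g ` (P - {X, Y})"
    have "g X \<noteq> g Y" using disj[OF XY(1,2,3)] False by auto
    moreover have "g X \<notin> B" "g Y \<notin> B"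
      using disj XY(1,2) False unfolding B_def by blast+
    moreover have "insert (g X \<union> g Y) B - {{}} = insert (g X \<union> g Y) (B - {{}})"
      using False by (simp add: insert_Diff_if)
    ultimately have "pullback S f P' = insert (g X \<union> g Y) (pullback S f P - {g X, g Y})"
      unfolding P P' B_def[symmetric] by simp blast
    moreover have "g X \<in> pullback S f P" "g Y \<in> pullback S f P"
      using False P by auto
    ultimately show ?thesis
      using \<open>g X \<noteq> g Y\<close> unfolding merges_to_def by blast
  qed
qed

text \<open>Both phases of the sequence are bounded by \<open>quotient_degree_bound\<close>. Among
  pullbacks a block of \<open>F\<close> has at most one preimage block, so multiplicity one
  suffices; among refinements of the fibre partition the multiplicity is at most the fibre size, and
  this is where the factor \<open>m\<close> comes from.\<close>

lemma stww_finite_walk_map: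
  fixes F :: "'a graph" and K :: "'b graph"
  assumes finF: "finite (verts F)" and adj: "adj F \<subseteq> verts F \<times> verts F"
    and tww: "stww_finite F \<le> enat t"
    and finK: "finite (verts K)" and f: "f \<in> verts K \<rightarrow> verts F"
    and walk: "\<And>x y. (x, y) \<in> adj K \<Longrightarrow> (f x, f y) \<in> (adj F)\<^sup>= ^^ k"
    and fib: "\<And>v. card {x \<in> verts K. f x = v} \<le> m"
  shows "stww_finite K \<le> enat (m * (t + 1) ^ k)"
proof (cases "verts K = {}")
  case True
  then show ?thesis by (simp add: stww_finite_empty)
next
  case False
  let ?S = "verts K" and ?w = "m * (t + 1) ^ k"
  let ?n = "card (verts F)"
  obtain P where seq: "partition_sequence F P" and wd: "sequence_width F P \<le> enat t"
    using stww_finite_obtain[OF tww] .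
  have part: "partition_on (verts F) (P i)" and deg: "max_degree (quotient_graph F (P i)) \<le> enat t"
    if "i \<in> {1..?n}" for i
    using seq wd that by (auto simp: partition_sequence_def Let_def sequence_width_def SUP_le_iff)
  have P1: "P 1 = {verts F}" and Pn: "P ?n = (\<lambda>v. {v}) ` verts F"
    and merge: "\<And>i. i \<in> {2..?n} \<Longrightarrow> merges_to (P i) (P (i - 1))"
    using seq by (auto simp: partition_sequence_def Let_def)
  obtain x0 where x0: "x0 \<in> ?S" using False by blast
  then have "verts F \<noteq> {}" using f by auto
  then have n1: "1 \<le> ?n" using finF by (simp add: Suc_leI card_gt_0_iff)
  \<comment> \<open>A nonempty fibre forces \<open>m\<close> to be positive, so multiplicity one in
    the pullback phase is covered by \<open>m\<close>.\<close>
  have "card {x \<in> ?S. f x = f x0} > 0" using x0 finK by (auto simp: card_gt_0_iff)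
  then have m1: "1 \<le> m" using fib[of "f x0"] by linarith

  have pb_deg: "max_degree (quotient_graph K (pullback ?S f (P i))) \<le> enat ?w"
    if i: "i \<in> {1..?n}" for i
  proof -
    have ex: "\<exists>X\<in>P i. B = {x \<in> ?S. f x \<in> X}" if "B \<in> pullback ?S f (P i)" for B
      using that by (auto simp: pullback_def)
    \<comment> \<open>A block with preimage \<open>B\<close> is chosen; as \<open>B\<close> is
      recovered from \<open>h B\<close> as its preimage, each \<open>X\<close> comes from at most
      one \<open>B\<close>.\<close>
    define h where "h B = (SOME X. X \<in> P i \<and> B = {x \<in> ?S. f x \<in> X})" for B
    have h: "h B \<in> P i \<and> B = {x \<in> ?S. f x \<in> h B}" if "B \<in> pullback ?S f (P i)" for B
      unfolding h_def by (rule someI_ex) (use ex[OF that] in blast)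
    have sub: "{B \<in> pullback ?S f (P i). h B = X} \<subseteq> {{x \<in> ?S. f x \<in> X}}" for X
      using h by auto
    show ?thesis
    proof (rule quotient_degree_bound[OF adj part[OF i] deg[OF i] walk])
      show "h B \<in> P i \<and> f ` B \<subseteq> h B" if "B \<in> pullback ?S f (P i)" for B
        using h[OF that] by blast
      show "finite {B \<in> pullback ?S f (P i). h B = X} \<and>
          card {B \<in> pullback ?S f (P i). h B = X} \<le> m" for X
        using card_mono[OF _ sub[of X]] finite_subset[OF sub[of X]] m1 by simp
    qed
  qed
  have pb_part: "partition_on ?S (pullback ?S f (P i))" if "i \<in> {1..?n}" for i
    using partition_on_pullback[OF part[OF that] f] .

  have down: "(contraction_step K ?w)\<^sup>*\<^sup>* (pullback ?S f (P i)) (pullback ?S f (P 1))"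
    if "1 \<le> i" "i \<le> ?n" for i
    using that
  proof (induction i rule: nat_induct_at_least)
    case (Suc i)
    then have i: "Suc i \<in> {1..?n}" "i \<in> {1..?n}" by auto
    have "merges_to (P (Suc i)) (P i)" using merge[of "Suc i"] Suc by simp
    from merges_to_pullback[OF this part[OF i(1)], of ?S f]
    have "pullback ?S f (P i) = pullback ?S f (P (Suc i)) \<or>
        contraction_step K ?w (pullback ?S f (P (Suc i))) (pullback ?S f (P i))"
      unfolding contraction_step_def using pb_part pb_deg i by blast
    then show ?case
      using Suc by (auto intro: converse_rtranclp_into_rtranclp)
  qed simp

  have pb1: "pullback ?S f (P 1) = {?S}"
    using f False unfolding P1 pullback_def by auto

  let ?Q = "pullback ?S f (P ?n)"
  have Q: "?Q = (\<lambda>v. {x \<in> ?S. f x = v}) ` verts F - {{}}"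
    unfolding Pn pullback_def by auto
  have nin: "?n \<in> {1..?n}" using n1 by simp
  \<comment> \<open>Below the fibre partition \<open>f\<close> is constant on each block, so the
    image of a block is a singleton, that is, a block of \<open>P ?n\<close>.\<close>
  have fine_deg: "max_degree (quotient_graph K R) \<le> enat ?w" if R: "refines ?S R ?Q" for R
  proof (rule quotient_degree_bound[OF adj part[OF nin] deg[OF nin] walk, where h = "image f"])
    have Rpart: "partition_on ?S R" using R by (simp add: refines_def)
    show "f ` B \<in> P ?n \<and> f ` B \<subseteq> f ` B" if B: "B \<in> R" for B
    proof -
      have "B \<noteq> {}" using Rpart B by (auto simp: partition_on_def)
      moreover obtain v where "v \<in> verts F" "B \<subseteq> {x \<in> ?S. f x = v}"
        using R B unfolding refines_def Q by auto
      ultimately have "f ` B = {v}" "v \<in> verts F" by auto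
      then show ?thesis by (simp add: Pn)
    qed
    show "finite {B \<in> R. f ` B = X} \<and> card {B \<in> R. f ` B = X} \<le> m" if X: "X \<in> P ?n" for X
    proof -
      obtain v where v: "X = {v}" using X Pn by auto
      define T where "T = {x \<in> ?S. f x = v}"
      have finT: "finite T" using finK by (simp add: T_def)
      \<comment> \<open>Any point of a block determines the block, so there are at most as many
        blocks over \<open>v\<close> as points in the fibre of \<open>v\<close>.\<close>
      have "{B \<in> R. f ` B = X} \<subseteq> (\<lambda>x. THE B. B \<in> R \<and> x \<in> B) ` T"
      proof
        fix B assume B: "B \<in> {B \<in> R. f ` B = X}"
        then obtain x where x: "x \<in> B" using v by blast
        have "x \<in> T" using x B v Rpart by (auto simp: T_def partition_on_def)
        moreover have "(THE B. B \<in> R \<and> x \<in> B) = B"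
          using x B Rpart by (intro the_equality) (auto simp: partition_on_def disjoint_def)
        ultimately show "B \<in> (\<lambda>x. THE B. B \<in> R \<and> x \<in> B) ` T" by force
      qed
      then show ?thesis
        using finT surj_card_le[OF finT] fib[of v] unfolding T_def[symmetric]
        by (meson finite_imageI finite_subset le_trans)
    qed
  qed
  have ref0: "refines ?S ((\<lambda>v. {v}) ` ?S) ?Q"
    unfolding refines_def
  proof (intro conjI ballI partition_on_singletons pb_part[OF nin])
    fix B assume "B \<in> (\<lambda>v. {v}) ` ?S"
    then show "\<exists>Y\<in>?Q. B \<subseteq> Y"
      using partition_onD1[OF pb_part[OF nin]] by blast
  qed
  have "(\<lambda>R R'. merges_to R R' \<and> refines ?S R ?Q \<and> refines ?S R' ?Q)\<^sup>*\<^sup>* ((\<lambda>v. {v}) ` ?S) ?Q"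
    by (rule refines_merge_path[OF finK ref0])
  moreover have "(\<lambda>R R'. merges_to R R' \<and> refines ?S R ?Q \<and> refines ?S R' ?Q)
      \<le> contraction_step K ?w"
    using fine_deg by (auto simp: contraction_step_def refines_def)
  ultimately have "(contraction_step K ?w)\<^sup>*\<^sup>* ((\<lambda>v. {v}) ` ?S) ?Q"
    using rtranclp_mono by blast
  then have "(contraction_step K ?w)\<^sup>*\<^sup>* ((\<lambda>v. {v}) ` ?S) {?S}"
    using down[OF n1 order_refl] unfolding pb1 by (rule rtranclp_trans)
  then show ?thesis using stww_finite_le[OF finK False fine_deg[OF ref0]] by blast
qed

section \<open>From finite subgraphs to infinite graphs\<close>

section \<open>Regular embeddings\<close>

lemma induced_subgraph_verts:
  fixes G :: "'a graph"
  assumes "adj G \<subseteq> verts G \<times> verts G"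
  shows "induced_subgraph G (verts G) = G"
  using assms by (simp add: induced_subgraph_def Int_absorb2)

text \<open>For infinite \<open>G\<close> one takes \<open>T = S\<close>. For finite
  \<open>G\<close> the value \<open>stww G\<close> concerns only \<open>G\<close> itself, so
  \<open>T\<close> is the whole vertex set; allowing \<open>T\<close> to exceed \<open>S\<close>
  avoids monotonicity under induced subgraphs.\<close>

lemma finite_twin_width_obtain:
  fixes G :: "'a graph"
  assumes "simple_graph G" "finite_twin_width G"
  obtains t where "\<And>S. finite S \<Longrightarrow> S \<subseteq> verts G \<Longrightarrow>
    \<exists>T. finite T \<and> S \<subseteq> T \<and> T \<subseteq> verts G \<and> stww_finite (induced_subgraph G T) \<le> enat t"
proof -
  obtain t where t: "stww G = enat t"
    using assms(2) unfolding finite_twin_width_def by (cases "stww G") auto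
  have "\<exists>T. finite T \<and> S \<subseteq> T \<and> T \<subseteq> verts G \<and> stww_finite (induced_subgraph G T) \<le> enat t"
    if S: "finite S" "S \<subseteq> verts G" for S
  proof (cases "finite (verts G)")
    case True
    have "stww_finite G = enat t" using t True by (simp add: stww_def)
    moreover have "adj G \<subseteq> verts G \<times> verts G" using assms(1) by (simp add: simple_graph_def)
    ultimately have "stww_finite (induced_subgraph G (verts G)) \<le> enat t"
      by (simp add: induced_subgraph_verts)
    then show ?thesis using S True by blast
  next
    case False
    then have "(SUP S\<in>{S. finite S \<and> S \<subseteq> verts G}. stww_finite (induced_subgraph G S)) \<le> enat t"
      using t by (simp add: stww_def)
    then have "stww_finite (induced_subgraph G S) \<le> enat t"
      using S by (simp add: SUP_le_iff)
    then show ?thesis using S by blast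
  qed
  then show ?thesis using that by blast
qed

lemma finite_twin_widthI:
  fixes G :: "'a graph"
  assumes "simple_graph G"
    and "\<And>S. finite S \<Longrightarrow> S \<subseteq> verts G \<Longrightarrow> stww_finite (induced_subgraph G S) \<le> enat w"
  shows "finite_twin_width G"
proof -
  have "adj G \<subseteq> verts G \<times> verts G" using assms(1) by (simp add: simple_graph_def)
  then have "stww G \<le> enat w"
    using assms(2)[of "verts G"] assms(2)
    by (auto simp: stww_def induced_subgraph_verts SUP_le_iff)
  then show ?thesis unfolding finite_twin_width_def using le_less_trans by fastforce
qed

lemma regular_embedding_twin_width:
  fixes G :: "'a graph" and H :: "'b graph"
  assumes G: "simple_graph G" "connected_graph G" and H: "simple_graph H" "connected_graph H"
    and emb: "regular_embedding c (graph_metric H) (graph_metric G) f"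
    and tww: "finite_twin_width G"
  shows "finite_twin_width H"
proof -
  have Gadj: "adj G \<subseteq> verts G \<times> verts G" and Hadj: "adj H \<subseteq> verts H \<times> verts H"
    using G H by (auto simp: simple_graph_def)
  have c: "c \<ge> 0" and f: "f \<in> verts H \<rightarrow> verts G"
    and lip: "\<And>x y. x \<in> verts H \<Longrightarrow> y \<in> verts H \<Longrightarrow>
        real (graph_dist G (f x) (f y)) \<le> c * real (graph_dist H x y)"
    and fib: "\<And>v. v \<in> verts G \<Longrightarrow> finite {x \<in> verts H. f x = v} \<and>
        real (card {x \<in> verts H. f x = v}) \<le> c"
    using emb unfolding regular_embedding_def
    by (auto simp: mspace_graph_metric mdist_graph_metric G H)
  \<comment> \<open>Distances and fibre sizes are integers, so rounding \<open>c\<close> down keeps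
    both bounds; \<open>k\<close> serves as walk length and as multiplicity.\<close>
  define k where "k = nat \<lfloor>c\<rfloor>"
  have near: "(f x, f y) \<in> (adj G)\<^sup>= ^^ k" if xy: "(x, y) \<in> adj H" for x y
  proof -
    have v: "x \<in> verts H" "y \<in> verts H" using xy Hadj by auto
    have "graph_dist H x y \<le> 1" by (rule graph_dist_le) (use xy in simp)
    then have "c * real (graph_dist H x y) \<le> c * 1" using c by (intro mult_left_mono) auto
    then have "real (graph_dist G (f x) (f y)) \<le> c" using lip[OF v] by linarith
    then have "graph_dist G (f x) (f y) \<le> k" unfolding k_def by (simp add: le_nat_floor)
    moreover have "(f x, f y) \<in> adj G ^^ graph_dist G (f x) (f y)"
      using graph_dist_walk[OF G(2)] f v by blast
    ultimately show ?thesis using relpow_subset_reflcl_relpow by blast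
  qed
  obtain t where t: "\<And>S. finite S \<Longrightarrow> S \<subseteq> verts G \<Longrightarrow>
      \<exists>T. finite T \<and> S \<subseteq> T \<and> T \<subseteq> verts G \<and> stww_finite (induced_subgraph G T) \<le> enat t"
    using finite_twin_width_obtain[OF G(1) tww] by blast
  have "stww_finite (induced_subgraph H S) \<le> enat (k * (t + 1) ^ k)"
    if S: "finite S" "S \<subseteq> verts H" for S
  proof -
    define E where "E = (\<lambda>(x, y). (f x, f y)) ` (adj H \<inter> S \<times> S)"
    have finE: "finite E" using S(1) by (simp add: E_def)
    have subE: "E \<subseteq> (adj G)\<^sup>= ^^ k" using near by (auto simp: E_def)
    obtain s where s: "s \<subseteq> (adj G)\<^sup>=" "finite s" "E \<subseteq> s ^^ k"
      using relpow_finite_subrel[OF finE subE] by (elim exE conjE)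
    \<comment> \<open>Loops in \<open>s\<close> may sit at points outside \<open>G\<close>, so only
      endpoints of proper edges are added. The loops return with the reflexive closure in the
      induced subgraph.\<close>
    have "finite (f ` S \<union> Field (s - Id))" using S(1) s(2) by (simp add: finite_Field)
    moreover have "f ` S \<union> Field (s - Id) \<subseteq> verts G"
      using S(2) f s(1) Gadj by (auto simp: Field_def)
    ultimately obtain T where T: "finite T" "f ` S \<union> Field (s - Id) \<subseteq> T" "T \<subseteq> verts G"
      "stww_finite (induced_subgraph G T) \<le> enat t"
      using t by meson
    have "s \<subseteq> (adj (induced_subgraph G T))\<^sup>="
      using s(1) T(2) by (auto simp: induced_subgraph_def Field_def)
    then have sk: "s ^^ k \<subseteq> (adj (induced_subgraph G T))\<^sup>= ^^ k" by (rule relpow_mono_rel)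
    show ?thesis
    proof (rule stww_finite_walk_map[OF _ _ T(4), of _ f])
      show "finite (verts (induced_subgraph G T))" "finite (verts (induced_subgraph H S))"
        using T(1) S(1) by (simp_all add: induced_subgraph_def)
      show "adj (induced_subgraph G T) \<subseteq> verts (induced_subgraph G T) \<times> verts (induced_subgraph G T)"
        by (simp add: induced_subgraph_def)
      show "f \<in> verts (induced_subgraph H S) \<rightarrow> verts (induced_subgraph G T)"
        using T(2) by (auto simp: induced_subgraph_def)
      show "(f x, f y) \<in> (adj (induced_subgraph G T))\<^sup>= ^^ k"
        if "(x, y) \<in> adj (induced_subgraph H S)" for x y
        using that sk s(3) by (force simp: induced_subgraph_def E_def)
      show "card {x \<in> verts (induced_subgraph H S). f x = v} \<le> k" for v
      proof (cases "v \<in> verts G")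
        case True
        have "card {x \<in> S. f x = v} \<le> card {x \<in> verts H. f x = v}"
          using fib[OF True] S(2) by (intro card_mono) auto
        also have "\<dots> \<le> k" using fib[OF True] by (simp add: k_def le_nat_floor)
        finally show ?thesis by (simp add: induced_subgraph_def)
      next
        case False
        then have "{x \<in> S. f x = v} = {}" using S(2) f by auto
        then have "card {x \<in> S. f x = v} = 0" by (simp only: card.empty)
        then show ?thesis by (simp add: induced_subgraph_def)
      qed
    qed
  qed
  then show ?thesis by (rule finite_twin_widthI[OF H(1)])
qed

section \<open>Regular embeddings from quasi-isometries\<close>

section \<open>Quasi-isometries\<close>

text \<open>Distinct vertices are at distance at least 1, so the additive constant is absorbed by
  doubling \<open>A\<close>. A fibre lies in a ball of radius \<open>R\<close> around any of its
  points, and bounded degree bounds the size of that ball.\<close>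

lemma coarse_map_regular_embedding:
  fixes G :: "'a graph" and H :: "'b graph"
  assumes G: "simple_graph G" "connected_graph G" "bounded_degree G"
    and H: "simple_graph H" "connected_graph H"
    and f: "f \<in> verts G \<rightarrow> verts H" and A: "A \<ge> 0"
    and lip: "\<And>x y. x \<in> verts G \<Longrightarrow> y \<in> verts G \<Longrightarrow>
        real (graph_dist H (f x) (f y)) \<le> A * real (graph_dist G x y) + A"
    and fib: "\<And>x y. x \<in> verts G \<Longrightarrow> y \<in> verts G \<Longrightarrow> f x = f y \<Longrightarrow> real (graph_dist G x y) \<le> R"
  shows "\<exists>c. regular_embedding c (graph_metric G) (graph_metric H) f"
proof -
  obtain d where d: "max_degree G \<le> enat d"
    using G(3) unfolding bounded_degree_def by (cases "max_degree G") auto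
  have adj: "adj G \<subseteq> verts G \<times> verts G" using G(1) by (simp add: simple_graph_def)
  define k where "k = nat \<lfloor>R\<rfloor>"
  define c where "c = max (2 * A) (real ((d + 1) ^ k))"
  have c: "c \<ge> 0" using A by (simp add: c_def)
  have fibre: "finite {x \<in> verts G. f x = v} \<and> real (card {x \<in> verts G. f x = v}) \<le> c" for v
  proof (cases "\<exists>x\<in>verts G. f x = v")
    case True
    then obtain x where x: "x \<in> verts G" "f x = v" by blast
    have sub: "{y \<in> verts G. f y = v} \<subseteq> ((adj G)\<^sup>= ^^ k) `` {x}"
    proof
      fix y assume y: "y \<in> {y \<in> verts G. f y = v}"
      then have "graph_dist G x y \<le> k" using fib[of x y] x by (simp add: k_def le_nat_floor)
      then show "y \<in> ((adj G)\<^sup>= ^^ k) `` {x}"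
        using relpow_subset_reflcl_relpow graph_dist_walk[OF G(2) x(1), of y] y by blast
    qed
    note ball = ball_card_le[OF adj d, of k x]
    have "card {y \<in> verts G. f y = v} \<le> (d + 1) ^ k"
      using card_mono[OF ball(1) sub] ball(2) by linarith
    then have "real (card {y \<in> verts G. f y = v}) \<le> real ((d + 1) ^ k)" by (rule of_nat_mono)
    then show ?thesis using finite_subset[OF sub ball(1)] unfolding c_def by linarith
  next
    case False
    then have "{x \<in> verts G. f x = v} = {}" by blast
    then show ?thesis using c by (simp only: finite.emptyI card.empty) simp
  qed
  have "real (graph_dist H (f x) (f y)) \<le> c * real (graph_dist G x y)"
    if xy: "x \<in> verts G" "y \<in> verts G" for x y
  proof (cases "x = y")
    case True
    have "graph_dist H (f x) (f x) \<le> 0" by (rule graph_dist_le) simp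
    then show ?thesis using True c by simp
  next
    case False
    interpret Metric_space "verts G" "\<lambda>u v. real (graph_dist G u v)"
      using Metric_space_graph_dist[OF G(1,2)] .
    have "real (graph_dist G x y) \<noteq> 0" using zero[OF xy] False by simp
    then have "1 \<le> real (graph_dist G x y)" by simp
    then have "A \<le> A * real (graph_dist G x y)" using mult_left_mono[OF _ A, of 1] by simp
    then have "real (graph_dist H (f x) (f y)) \<le> (2 * A) * real (graph_dist G x y)"
      using lip[OF xy] by linarith
    also have "\<dots> \<le> c * real (graph_dist G x y)" by (intro mult_right_mono) (auto simp: c_def)
    finally show ?thesis .
  qed
  then have "regular_embedding c (graph_metric G) (graph_metric H) f"
    unfolding regular_embedding_def using c f fibre
    by (simp add: mspace_graph_metric mdist_graph_metric G H)
  then show ?thesis ..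
qed

lemma quasi_isometric_regular_embeddings:
  fixes G :: "'a graph" and H :: "'b graph"
  assumes G: "simple_graph G" "connected_graph G" "bounded_degree G"
    and H: "simple_graph H" "connected_graph H" "bounded_degree H"
    and "quasi_isometric (graph_metric G) (graph_metric H)"
  shows "\<exists>c f. regular_embedding c (graph_metric G) (graph_metric H) f"
    and "\<exists>c g. regular_embedding c (graph_metric H) (graph_metric G) g"
proof -
  obtain c f where qi: "quasi_isometry c (graph_metric G) (graph_metric H) f"
    using assms(7) by (auto simp: quasi_isometric_def)
  let ?dG = "\<lambda>x y. real (graph_dist G x y)" and ?dH = "\<lambda>x y. real (graph_dist H x y)"
  have c: "c > 0" and f: "f \<in> verts G \<rightarrow> verts H"
    and lower: "\<And>x y. x \<in> verts G \<Longrightarrow> y \<in> verts G \<Longrightarrow> 1 / c * ?dG x y - c \<le> ?dH (f x) (f y)"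
    and upper: "\<And>x y. x \<in> verts G \<Longrightarrow> y \<in> verts G \<Longrightarrow> ?dH (f x) (f y) \<le> c * ?dG x y + c"
    and dense: "\<And>y. y \<in> verts H \<Longrightarrow> \<exists>x\<in>verts G. ?dH y (f x) \<le> c"
    using qi unfolding quasi_isometry_def
    by (auto simp: mspace_graph_metric mdist_graph_metric G H)
  interpret mH: Metric_space "verts H" ?dH
    using Metric_space_graph_dist[OF H(1,2)] .
  have lower': "?dG x y \<le> c * (?dH (f x) (f y) + c)" if "x \<in> verts G" "y \<in> verts G" for x y
  proof -
    have "1 / c * ?dG x y \<le> ?dH (f x) (f y) + c" using lower[OF that] by linarith
    then have "c * (1 / c * ?dG x y) \<le> c * (?dH (f x) (f y) + c)" using c by (intro mult_left_mono) auto
    then show ?thesis using c by simp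
  qed
  show "\<exists>c f. regular_embedding c (graph_metric G) (graph_metric H) f"
  proof -
    \<comment> \<open>The lower quasi-isometry bound at image distance 0 bounds the diameter of the
      fibres of \<open>f\<close>.\<close>
    have "?dG x y \<le> c * c" if "x \<in> verts G" "y \<in> verts G" "f x = f y" for x y
    proof -
      have "f y \<in> verts H" using f that(2) by blast
      then have "?dH (f x) (f y) = 0" using mH.zero[of "f y" "f y"] that(3) by simp
      then show ?thesis using lower'[OF that(1,2)] by simp
    qed
    then show ?thesis
      using coarse_map_regular_embedding[OF G H(1,2) f less_imp_le[OF c] upper] by blast
  qed
  \<comment> \<open>A quasi-inverse: \<open>g y\<close> is a vertex whose image under
    \<open>f\<close> is within \<open>c\<close> of \<open>y\<close>.\<close>
  define g where "g y = (SOME x. x \<in> verts G \<and> ?dH y (f x) \<le> c)" for y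
  have g: "g y \<in> verts G \<and> ?dH y (f (g y)) \<le> c" if "y \<in> verts H" for y
    unfolding g_def by (rule someI_ex) (use dense[OF that] in blast)
  have fg: "f (g y) \<in> verts H" if "y \<in> verts H" for y using g[OF that] f by blast
  \<comment> \<open>Moving from \<open>f (g x)\<close> and \<open>f (g y)\<close> to
    \<open>x\<close> and \<open>y\<close> costs \<open>2 * c\<close>, and the lower bound adds
    another \<open>c\<close> before multiplication by \<open>c\<close>; hence the additive term
    \<open>3 * c * c\<close>.\<close>
  define A where "A = max c (3 * c * c)"
  have lip: "?dG (g x) (g y) \<le> A * ?dH x y + A" if xy: "x \<in> verts H" "y \<in> verts H" for x y
  proof -
    have "?dH (f (g x)) (f (g y)) \<le> ?dH (f (g x)) x + ?dH x y + ?dH y (f (g y))"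
      using mH.triangle[OF fg[OF xy(1)] xy(1) fg[OF xy(2)]] mH.triangle[OF xy fg[OF xy(2)]]
      by linarith
    also have "\<dots> \<le> ?dH x y + 2 * c"
      using g[OF xy(1)] g[OF xy(2)] mH.commute[of "f (g x)" x] by linarith
    finally have "c * (?dH (f (g x)) (f (g y)) + c) \<le> c * (?dH x y + 3 * c)"
      using c by (intro mult_left_mono) auto
    then have "?dG (g x) (g y) \<le> c * ?dH x y + 3 * c * c"
      using lower'[of "g x" "g y"] g[OF xy(1)] g[OF xy(2)] by (simp add: algebra_simps)
    moreover have "c * ?dH x y \<le> A * ?dH x y" by (intro mult_right_mono) (auto simp: A_def)
    moreover have "3 * c * c \<le> A" by (simp add: A_def)
    ultimately show ?thesis by linarith
  qed
  \<comment> \<open>Both \<open>x\<close> and \<open>y\<close> are within \<open>c\<close> of the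
    common point \<open>f (g x) = f (g y)\<close>.\<close>
  have fib: "?dH x y \<le> 2 * c" if xy: "x \<in> verts H" "y \<in> verts H" "g x = g y" for x y
    using mH.triangle[OF xy(1) fg[OF xy(1)] xy(2)] g[OF xy(1)] g[OF xy(2)] xy(3)
      mH.commute[of "f (g x)" y] by simp
  have "A \<ge> 0" "g \<in> verts H \<rightarrow> verts G" using c g by (auto simp: A_def)
  then show "\<exists>c g. regular_embedding c (graph_metric H) (graph_metric G) g"
    using coarse_map_regular_embedding[OF H G(1,2) _ _ lip fib] by blast
qed

theorem mainTheorem4:
  fixes G :: "'a graph" and H :: "'b graph"
  assumes "simple_graph G" and "connected_graph G" and "bounded_degree G"
    and "simple_graph H" and "connected_graph H" and "bounded_degree H"
  shows "((\<exists>c f. regular_embedding c (graph_metric H) (graph_metric G) f) \<longrightarrow>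
            finite_twin_width G \<longrightarrow> finite_twin_width H) \<and>
         (quasi_isometric (graph_metric G) (graph_metric H) \<longrightarrow>
            (finite_twin_width G \<longleftrightarrow> finite_twin_width H))"
  \<comment> \<open>An embedding carries finiteness from its target back to its source, so the
    equivalence takes one embedding in each direction.\<close>
  using regular_embedding_twin_width[OF assms(1,2,4,5)]
    regular_embedding_twin_width[OF assms(4,5,1,2)]
    quasi_isometric_regular_embeddings[OF assms] by blast

end
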